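(* Let $([\nabla],[h])$ be a naive Einstein Riemannian signature AH structure on an oriented surface $M$, with aligned representative $\nabla$. Then $([\nabla],[h])$ is Einstein if and only if its complex weighted scalar curvature $\mathsf S=R-i\,\mathsf F$ is a holomorphic section of $|\mathrm{Det}\,T^*M|\otimes_{\mathbb R}\mathbb C$ with respect to the holomorphic structure $\nabla^{0,1}$, i.e. $\nabla^{0,1}\mathsf S=0$.
   Context: A projective structure $[\nabla]$ is a class of torsion-free affine connections with the same unparametrized geodesics. An AH structure on a surface is a pair $([\nabla],[h])$ of a projective structure and a conformal structure. Let $H_{ij}=|\det h|^{-1/2}h_{ij}$ (independent of $h\in[h]$), with inverse $H^{ij}$. The aligned representative is the unique torsion-free $\nabla\in[\nabla]$ with $\nabla_{[i}H_{j]k}=0$ (equivalently $2h^{pq}\nabla_ph_{qi}=h^{pq}\nabla_ih_{pq}$ for all $h\in[h]$). Curvature of the aligned $\nabla$: $2\nabla_{[i}\nabla_{j]}X^k=R_{ijp}{}^kX^p$, $R_{ij}=R_{pij}{}^p$, $R=H^{ij}R_{ij}$ (weighted scalar curvature, a section of the bundle $|\mathrm{Det}\,T^*M|$ of $1$-densities), $F_{ij}=-R_{[ij]}$ (Faraday form). The AH structure is naive Einstein if $R_{(ij)}=\tfrac12RH_{ij}$, and Einstein if in addition $\nabla_iR+2H^{pq}\nabla_qF_{ip}=0$. $J$ is the complex structure determined by $[h]$ and the orientation; for $h\in[h]$, $\omega_{ij}=J_i{}^ph_{pj}$ is the Kähler form, the function $\mathsf F_h$ is defined by $2F_{ij}=\mathsf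 F_h\,\omega_{ij}$, and $\mathsf F=\mathsf F_h|\det h|^{1/2}$ is a $1$-density independent of the choice of $h\in[h]$. $\nabla^{0,1}$ is the $(0,1)$ part of the connection induced by the aligned representative on $|\mathrm{Det}\,T^*M|\otimes_{\mathbb R}\mathbb C$. *)

theory Defs
  imports "HOL-Analysis.Analysis"
begin

section \<open>Smooth maps and oriented surfaces\<close>

text \<open>Iterated directional derivatives. A map is of class \<open>C\<^sup>\<infinity>\<close> on an open set iff all of them
  exist and are differentiable there.\<close>

fun iterated_derivative ::
  "'a list \<Rightarrow> ('a::real_normed_vector \<Rightarrow> 'b::real_normed_vector) \<Rightarrow> 'a \<Rightarrow> 'b" where
  "iterated_derivative [] f = f"
| "iterated_derivative (v # vs) f =
     (\<lambda>x. frechet_derivative (iterated_derivative vs f) (at x) v)"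

definition smooth_on ::
  "'a set \<Rightarrow> ('a::real_normed_vector \<Rightarrow> 'b::real_normed_vector) \<Rightarrow> bool" where
  "smooth_on U f \<longleftrightarrow>
     open U \<and> (\<forall>vs. \<forall>x\<in>U. iterated_derivative vs f differentiable (at x))"

definition pd :: "2 \<Rightarrow> (real^2 \<Rightarrow> 'b::real_normed_vector) \<Rightarrow> real^2 \<Rightarrow> 'b" where
  "pd i f x = frechet_derivative f (at x) (axis i 1)"

text \<open>A chart is a domain together with a coordinate map, whose values off the domain are
  irrelevant.\<close>

type_synonym 'a chart = "'a set \<times> ('a \<Rightarrow> real^2)"

abbreviation chart_dom :: "'a chart \<Rightarrow> 'a set" where "chart_dom \<equiv> fst"
abbreviation chart_map :: "'a chart \<Rightarrow> 'a \<Rightarrow> real^2" where "chart_map \<equiv> snd"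

definition chart_img :: "'a chart \<Rightarrow> (real^2) set" where
  "chart_img a = chart_map a ` chart_dom a"

definition overlap :: "'a chart \<Rightarrow> 'a chart \<Rightarrow> (real^2) set" where
  "overlap a b = chart_map a ` (chart_dom a \<inter> chart_dom b)"

definition transition :: "'a chart \<Rightarrow> 'a chart \<Rightarrow> real^2 \<Rightarrow> real^2" where
  "transition a b x = chart_map b (inv_into (chart_dom a) (chart_map a) x)"

definition jacobian :: "'a chart \<Rightarrow> 'a chart \<Rightarrow> real^2 \<Rightarrow> real^2^2" where
  "jacobian a b x = matrix (frechet_derivative (transition a b) (at x))"

text \<open>An oriented smooth surface, given by an oriented smooth atlas \<open>A\<close> (not necessarily
  maximal) on the topological space \<open>T\<close>.\<close>

definition oriented_surface :: "'a topology \<Rightarrow> 'a chart set \<Rightarrow> bool" where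
  "oriented_surface T A \<longleftrightarrow>
     Hausdorff_space T \<and> second_countable T \<and>
     (\<Union>a\<in>A. chart_dom a) = topspace T \<and>
     (\<forall>a\<in>A. openin T (chart_dom a) \<and> open (chart_img a) \<and>
        homeomorphic_map (subtopology T (chart_dom a)) (top_of_set (chart_img a)) (chart_map a)) \<and>
     (\<forall>a\<in>A. \<forall>b\<in>A. smooth_on (overlap a b) (transition a b) \<and>
        (\<forall>x\<in>overlap a b. det (jacobian a b x) > 0))"

section \<open>Connections and projective structures\<close>

text \<open>Sections of tensor and density bundles are given by their components in the charts of the
  atlas, as functions of the coordinates. Values outside \<open>chart_img a\<close>, or for \<open>a\<close> not in the
  atlas, are irrelevant.

  A connection is given by its Christoffel symbols: \<open>\<nabla> a x i j k\<close> is \<open>\<Gamma>\<^bsub>ij\<^esub>\<^sup>k\<close> at \<open>x\<close> in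
  the chart \<open>a\<close>, with the convention \<open>\<nabla>\<^sub>i X\<^sup>k = \<partial>\<^sub>i X\<^sup>k + \<Gamma>\<^bsub>ip\<^esub>\<^sup>k X\<^sup>p\<close>.\<close>

type_synonym christoffel = "real^2 \<Rightarrow> 2 \<Rightarrow> 2 \<Rightarrow> 2 \<Rightarrow> real"
type_synonym 'a connection = "'a chart \<Rightarrow> christoffel"

definition affine_connection :: "'a chart set \<Rightarrow> 'a connection \<Rightarrow> bool" where
  "affine_connection A D \<longleftrightarrow>
     (\<forall>a\<in>A. \<forall>i j k. smooth_on (chart_img a) (\<lambda>x. D a x i j k)) \<and>
     (\<forall>a\<in>A. \<forall>b\<in>A. \<forall>x\<in>overlap a b. \<forall>i j k.
        (\<Sum>m\<in>UNIV. jacobian a b x $ k $ m * D a x i j m) =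
          pd i (pd j (transition a b)) x $ k +
          (\<Sum>p\<in>UNIV. \<Sum>q\<in>UNIV. jacobian a b x $ p $ i * jacobian a b x $ q $ j *
             D b (transition a b x) p q k))"

definition torsion_free :: "'a chart set \<Rightarrow> 'a connection \<Rightarrow> bool" where
  "torsion_free A D \<longleftrightarrow> (\<forall>a\<in>A. \<forall>x\<in>chart_img a. \<forall>i j k. D a x i j k = D a x j i k)"

definition smooth_curve ::
  "'a topology \<Rightarrow> 'a chart set \<Rightarrow> real set \<Rightarrow> (real \<Rightarrow> 'a) \<Rightarrow> bool" where
  "smooth_curve T A I c \<longleftrightarrow>
     open I \<and> is_interval I \<and> I \<noteq> {} \<and> continuous_map (top_of_set I) T c \<and>
     (\<forall>a\<in>A. smooth_on {t\<in>I. c t \<in> chart_dom a} (chart_map a \<circ> c))"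

definition velocity :: "(real \<Rightarrow> real^2) \<Rightarrow> real \<Rightarrow> real^2" where
  "velocity x t = vector_derivative x (at t)"

text \<open>An affinely parametrized geodesic: \<open>\<nabla>\<^bsub>c'\<^esub> c' = 0\<close>.\<close>

definition geodesic ::
  "'a topology \<Rightarrow> 'a chart set \<Rightarrow> 'a connection \<Rightarrow> real set \<Rightarrow> (real \<Rightarrow> 'a) \<Rightarrow> bool" where
  "geodesic T A D I c \<longleftrightarrow>
     smooth_curve T A I c \<and>
     (\<forall>a\<in>A. \<forall>t\<in>I. c t \<in> chart_dom a \<longrightarrow>
        (\<forall>k. velocity (velocity (chart_map a \<circ> c)) t $ k +
           (\<Sum>i\<in>UNIV. \<Sum>j\<in>UNIV. D a (chart_map a (c t)) i j k *
              velocity (chart_map a \<circ> c) t $ i * velocity (chart_map a \<circ> c) t $ j) = 0))"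

definition unparametrized_geodesic ::
  "'a topology \<Rightarrow> 'a chart set \<Rightarrow> 'a connection \<Rightarrow> real set \<Rightarrow> (real \<Rightarrow> 'a) \<Rightarrow> bool" where
  "unparametrized_geodesic T A D I c \<longleftrightarrow>
     (\<exists>I' s. is_interval I' \<and> smooth_on I' s \<and> (\<forall>t\<in>I'. deriv s t \<noteq> 0) \<and>
        s ` I' = I \<and> geodesic T A D I' (c \<circ> s))"

definition projectively_equivalent ::
  "'a topology \<Rightarrow> 'a chart set \<Rightarrow> 'a connection \<Rightarrow> 'a connection \<Rightarrow> bool" where
  "projectively_equivalent T A D D' \<longleftrightarrow>
     (\<forall>I c. unparametrized_geodesic T A D I c \<longleftrightarrow> unparametrized_geodesic T A D' I c)"

definition projective_structure ::
  "'a topology \<Rightarrow> 'a chart set \<Rightarrow> 'a connection set \<Rightarrow> bool" where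
  "projective_structure T A P \<longleftrightarrow>
     (\<exists>D. affine_connection A D \<and> torsion_free A D \<and>
        P = {D'. affine_connection A D' \<and> torsion_free A D' \<and> projectively_equivalent T A D D'})"

section \<open>Conformal structures and AH structures\<close>

text \<open>\<open>h a x $ i $ j\<close> is the component \<open>h\<^bsub>ij\<^esub>\<close> at \<open>x\<close> in the chart \<open>a\<close>.\<close>

type_synonym 'a metric = "'a chart \<Rightarrow> real^2 \<Rightarrow> real^2^2"

definition pos_def :: "real^2^2 \<Rightarrow> bool" where
  "pos_def g \<longleftrightarrow> transpose g = g \<and> (\<forall>v. v \<noteq> 0 \<longrightarrow> v \<bullet> (g *v v) > 0)"

definition riemannian_metric :: "'a chart set \<Rightarrow> 'a metric \<Rightarrow> bool" where
  "riemannian_metric A h \<longleftrightarrow>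
     (\<forall>a\<in>A. smooth_on (chart_img a) (h a) \<and> (\<forall>x\<in>chart_img a. pos_def (h a x))) \<and>
     (\<forall>a\<in>A. \<forall>b\<in>A. \<forall>x\<in>overlap a b.
        h a x = transpose (jacobian a b x) ** h b (transition a b x) ** jacobian a b x)"

definition conformally_equivalent :: "'a chart set \<Rightarrow> 'a metric \<Rightarrow> 'a metric \<Rightarrow> bool" where
  "conformally_equivalent A h h' \<longleftrightarrow>
     (\<exists>f. \<forall>a\<in>A. \<forall>p\<in>chart_dom a. f p > 0 \<and> h' a (chart_map a p) = f p *\<^sub>R h a (chart_map a p))"

definition conformal_structure :: "'a chart set \<Rightarrow> 'a metric set \<Rightarrow> bool" where
  "conformal_structure A C \<longleftrightarrow>
     (\<exists>h. riemannian_metric A h \<and>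
        C = {h'. riemannian_metric A h' \<and> conformally_equivalent A h h'})"

definition AH_structure ::
  "'a topology \<Rightarrow> 'a chart set \<Rightarrow> 'a connection set \<Rightarrow> 'a metric set \<Rightarrow> bool" where
  "AH_structure T A P C \<longleftrightarrow> projective_structure T A P \<and> conformal_structure A C"

definition repr_metric :: "'a metric set \<Rightarrow> 'a metric" where
  "repr_metric C = (SOME h. h \<in> C)"

text \<open>\<open>H\<^bsub>ij\<^esub> = |det h|\<^sup>-\<^sup>1\<^sup>/\<^sup>2 h\<^bsub>ij\<^esub>\<close> does not depend on the representative, see
  \<open>weighted_metric_eq\<close> below.\<close>

definition unimodular :: "real^2^2 \<Rightarrow> real^2^2" where
  "unimodular g = (1 / sqrt \<bar>det g\<bar>) *\<^sub>R g"

definition weighted_metric :: "'a metric set \<Rightarrow> 'a chart \<Rightarrow> real^2 \<Rightarrow> real^2^2" where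
  "weighted_metric C a x = unimodular (repr_metric C a x)"

definition inv_weighted_metric :: "'a metric set \<Rightarrow> 'a chart \<Rightarrow> real^2 \<Rightarrow> real^2^2" where
  "inv_weighted_metric C a x = matrix_inv (weighted_metric C a x)"

section \<open>Covariant derivatives and curvature\<close>

text \<open>Covariant derivatives in a chart, for vector fields \<open>X\<^sup>k\<close>, for tensors \<open>T\<^sub>j\<^sup>k\<close>, for
  sections \<open>T\<^bsub>jk\<^esub>\<close> of \<open>\<Otimes>\<^sup>2T\<^sup>*M \<otimes> |Det T\<^sup>*M|\<^sup>w\<close>, and for (real or complex) 1-densities. The
  connection induced on \<open>|Det T\<^sup>*M|\<^sup>w\<close> is \<open>\<partial>\<^sub>i - w \<Gamma>\<^bsub>ip\<^esub>\<^sup>p\<close>.\<close>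

definition nabla_vec :: "christoffel \<Rightarrow> (real^2 \<Rightarrow> 2 \<Rightarrow> real) \<Rightarrow> real^2 \<Rightarrow> 2 \<Rightarrow> 2 \<Rightarrow> real" where
  "nabla_vec \<Gamma> X x i k = pd i (\<lambda>y. X y k) x + (\<Sum>p\<in>UNIV. \<Gamma> x i p k * X x p)"

definition nabla_endo ::
  "christoffel \<Rightarrow> (real^2 \<Rightarrow> 2 \<Rightarrow> 2 \<Rightarrow> real) \<Rightarrow> real^2 \<Rightarrow> 2 \<Rightarrow> 2 \<Rightarrow> 2 \<Rightarrow> real" where
  "nabla_endo \<Gamma> S x i j k =
     pd i (\<lambda>y. S y j k) x - (\<Sum>p\<in>UNIV. \<Gamma> x i j p * S x p k) + (\<Sum>p\<in>UNIV. \<Gamma> x i p k * S x j p)"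

definition nabla_cov2 ::
  "christoffel \<Rightarrow> real \<Rightarrow> (real^2 \<Rightarrow> 2 \<Rightarrow> 2 \<Rightarrow> real) \<Rightarrow> real^2 \<Rightarrow> 2 \<Rightarrow> 2 \<Rightarrow> 2 \<Rightarrow> real" where
  "nabla_cov2 \<Gamma> w S x i j k =
     pd i (\<lambda>y. S y j k) x - (\<Sum>p\<in>UNIV. \<Gamma> x i j p * S x p k) - (\<Sum>p\<in>UNIV. \<Gamma> x i k p * S x j p)
     - w * (\<Sum>p\<in>UNIV. \<Gamma> x i p p) * S x j k"

definition nabla_density ::
  "christoffel \<Rightarrow> (real^2 \<Rightarrow> 'b::real_normed_vector) \<Rightarrow> real^2 \<Rightarrow> 2 \<Rightarrow> 'b" where
  "nabla_density \<Gamma> s x i = pd i s x - (\<Sum>p\<in>UNIV. \<Gamma> x i p p) *\<^sub>R s x"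

text \<open>\<open>R\<^bsub>ijp\<^esub>\<^sup>k\<close>, obtained by applying \<open>2\<nabla>\<^bsub>[i\<^esub>\<nabla>\<^bsub>j]\<^esub>\<close> to the coordinate field \<open>\<partial>\<^sub>p\<close>. See
  \<open>Ricci_identity\<close> below for arbitrary vector fields.\<close>

definition curvature :: "christoffel \<Rightarrow> real^2 \<Rightarrow> 2 \<Rightarrow> 2 \<Rightarrow> 2 \<Rightarrow> 2 \<Rightarrow> real" where
  "curvature \<Gamma> x i j p k =
     (let E = (\<lambda>_ l. if l = p then 1 else 0) in
      nabla_endo \<Gamma> (nabla_vec \<Gamma> E) x i j k - nabla_endo \<Gamma> (nabla_vec \<Gamma> E) x j i k)"

definition ricci :: "christoffel \<Rightarrow> real^2 \<Rightarrow> 2 \<Rightarrow> 2 \<Rightarrow> real" where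
  "ricci \<Gamma> x i j = (\<Sum>p\<in>UNIV. curvature \<Gamma> x p i j p)"

definition faraday :: "christoffel \<Rightarrow> real^2 \<Rightarrow> 2 \<Rightarrow> 2 \<Rightarrow> real" where
  "faraday \<Gamma> x i j = - ((ricci \<Gamma> x i j - ricci \<Gamma> x j i) / 2)"

definition weighted_scalar_curvature ::
  "'a metric set \<Rightarrow> 'a connection \<Rightarrow> 'a chart \<Rightarrow> real^2 \<Rightarrow> real" where
  "weighted_scalar_curvature C D a x =
     (\<Sum>i\<in>UNIV. \<Sum>j\<in>UNIV. inv_weighted_metric C a x $ i $ j * ricci (D a) x i j)"

section \<open>Aligned representative and Einstein equations\<close>

definition aligned_representative ::
  "'a chart set \<Rightarrow> 'a connection set \<Rightarrow> 'a metric set \<Rightarrow> 'a connection \<Rightarrow> bool" where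
  "aligned_representative A P C D \<longleftrightarrow>
     D \<in> P \<and> torsion_free A D \<and>
     (\<forall>a\<in>A. \<forall>x\<in>chart_img a. \<forall>i j k.
        nabla_cov2 (D a) (-1) (\<lambda>y l m. weighted_metric C a y $ l $ m) x i j k =
        nabla_cov2 (D a) (-1) (\<lambda>y l m. weighted_metric C a y $ l $ m) x j i k)"

text \<open>In the following, \<open>D\<close> is the aligned representative of the AH structure.\<close>

definition naive_Einstein :: "'a chart set \<Rightarrow> 'a metric set \<Rightarrow> 'a connection \<Rightarrow> bool" where
  "naive_Einstein A C D \<longleftrightarrow>
     (\<forall>a\<in>A. \<forall>x\<in>chart_img a. \<forall>i j.
        (ricci (D a) x i j + ricci (D a) x j i) / 2 =
        1/2 * weighted_scalar_curvature C D a x * weighted_metric C a x $ i $ j)"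

definition Einstein :: "'a chart set \<Rightarrow> 'a metric set \<Rightarrow> 'a connection \<Rightarrow> bool" where
  "Einstein A C D \<longleftrightarrow>
     naive_Einstein A C D \<and>
     (\<forall>a\<in>A. \<forall>x\<in>chart_img a. \<forall>i.
        nabla_density (D a) (weighted_scalar_curvature C D a) x i +
        2 * (\<Sum>p\<in>UNIV. \<Sum>q\<in>UNIV. inv_weighted_metric C a x $ p $ q *
               nabla_cov2 (D a) 0 (faraday (D a)) x q i p) = 0)"

section \<open>Complex structure and complex weighted scalar curvature\<close>

text \<open>Components \<open>J $ i $ j\<close> stand for \<open>J\<^sub>i\<^sup>j\<close>, so \<open>J\<close> acts on tangent vectors by
  \<open>X\<^sup>i \<mapsto> X\<^sup>p J\<^sub>p\<^sup>i\<close>, that is by \<open>X v* J\<close>. It is orthogonal, squares to minus the identity, and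
  \<open>(X, J X)\<close> is positively oriented for \<open>X \<noteq> 0\<close>.\<close>

definition compatible_complex_structure :: "real^2^2 \<Rightarrow> real^2^2 \<Rightarrow> bool" where
  "compatible_complex_structure g J \<longleftrightarrow>
     J ** J = - mat 1 \<and>
     (\<forall>X Y. (X v* J) \<bullet> (g *v (Y v* J)) = X \<bullet> (g *v Y)) \<and>
     (\<forall>X. X \<noteq> 0 \<longrightarrow> det (vector [X, X v* J] :: real^2^2) > 0)"

definition metric_J :: "real^2^2 \<Rightarrow> real^2^2" where
  "metric_J g = (THE J. compatible_complex_structure g J)"

definition complex_structure :: "'a metric set \<Rightarrow> 'a chart \<Rightarrow> real^2 \<Rightarrow> real^2^2" where
  "complex_structure C a x = metric_J (repr_metric C a x)"

definition kaehler_form :: "real^2^2 \<Rightarrow> real^2^2" where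
  "kaehler_form g = metric_J g ** g"

definition faraday_function :: "'a metric \<Rightarrow> 'a connection \<Rightarrow> 'a chart \<Rightarrow> real^2 \<Rightarrow> real" where
  "faraday_function h D a x =
     (THE f. \<forall>i j. 2 * faraday (D a) x i j = f * kaehler_form (h a x) $ i $ j)"

definition faraday_density ::
  "'a metric set \<Rightarrow> 'a connection \<Rightarrow> 'a chart \<Rightarrow> real^2 \<Rightarrow> real" where
  "faraday_density C D a x =
     faraday_function (repr_metric C) D a x * sqrt \<bar>det (repr_metric C a x)\<bar>"

definition complex_weighted_scalar_curvature ::
  "'a metric set \<Rightarrow> 'a connection \<Rightarrow> 'a chart \<Rightarrow> real^2 \<Rightarrow> complex" where
  "complex_weighted_scalar_curvature C D a x =
     of_real (weighted_scalar_curvature C D a x) - \<i> * of_real (faraday_density C D a x)"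

text \<open>The (0,1) part of \<open>\<nabla>s\<close> is \<open>1/2 (\<nabla>\<^sub>i s + \<i> J\<^sub>i\<^sup>p \<nabla>\<^sub>p s)\<close>: a complex 1-form \<open>\<alpha>\<close> has type (0,1)
  iff \<open>\<alpha>(J X) = - \<i> \<alpha>(X)\<close>.\<close>

definition nabla01 ::
  "'a metric set \<Rightarrow> 'a connection \<Rightarrow> ('a chart \<Rightarrow> real^2 \<Rightarrow> complex) \<Rightarrow>
   'a chart \<Rightarrow> real^2 \<Rightarrow> 2 \<Rightarrow> complex" where
  "nabla01 C D s a x i =
     1/2 * (nabla_density (D a) (s a) x i +
            \<i> * (\<Sum>p\<in>UNIV. of_real (complex_structure C a x $ i $ p) * nabla_density (D a) (s a) x p))"

definition holomorphic_density ::
  "'a chart set \<Rightarrow> 'a metric set \<Rightarrow> 'a connection \<Rightarrow> ('a chart \<Rightarrow> real^2 \<Rightarrow> complex) \<Rightarrow> bool" where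
  "holomorphic_density A C D s \<longleftrightarrow> (\<forall>a\<in>A. \<forall>x\<in>chart_img a. \<forall>i. nabla01 C D s a x i = 0)"

section \<open>Well-definedness\<close>

lemma det_scaleR_2: "det (c *\<^sub>R (g :: real^2^2)) = c\<^sup>2 * det g"
  by (simp add: det_2 power2_eq_square algebra_simps)

lemma unimodular_scaleR: "c > 0 \<Longrightarrow> unimodular (c *\<^sub>R g) = unimodular g"
  by (simp add: unimodular_def det_scaleR_2 abs_mult real_sqrt_mult)

lemma conformal_structure_repr_scale:
  assumes "conformal_structure A C" "h \<in> C" "a \<in> A" "x \<in> chart_img a"
  obtains c where "c > 0" "repr_metric C a x = c *\<^sub>R h a x"
proof -
  obtain h0 where C: "C = {h'. riemannian_metric A h' \<and> conformally_equivalent A h0 h'}"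
    using assms(1) unfolding conformal_structure_def by blast
  have r: "repr_metric C \<in> C"
    unfolding repr_metric_def using assms(2) by (metis someI_ex)
  obtain p where p: "p \<in> chart_dom a" "x = chart_map a p"
    using assms(4) unfolding chart_img_def by blast
  obtain f where f: "f p > 0" "h a x = f p *\<^sub>R h0 a x"
    using assms(2,3) p unfolding C conformally_equivalent_def by blast
  obtain f' where f': "f' p > 0" "repr_metric C a x = f' p *\<^sub>R h0 a x"
    using r assms(3) p C unfolding conformally_equivalent_def by blast
  have "repr_metric C a x = (f' p / f p) *\<^sub>R h a x"
    using f f' by simp
  with f f' show thesis by (intro that[of "f' p / f p"]) auto
qed

lemma weighted_metric_eq:
  assumes "conformal_structure A C" "h \<in> C" "a \<in> A" "x \<in> chart_img a"
  shows "weighted_metric C a x = (1 / sqrt \<bar>det (h a x)\<bar>) *\<^sub>R h a x"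
proof -
  obtain c where "c > 0" "repr_metric C a x = c *\<^sub>R h a x"
    using conformal_structure_repr_scale[OF assms] .
  then show ?thesis
    unfolding weighted_metric_def by (simp add: unimodular_scaleR) (simp add: unimodular_def)
qed

lemma pos_def_2:
  assumes "pos_def g"
  shows "g $ 2 $ 1 = g $ 1 $ 2" "g $ 1 $ 1 > 0" "det g > 0"
proof -
  have "transpose g $ 1 $ 2 = g $ 1 $ 2"
    using assms unfolding pos_def_def by metis
  then show sym: "g $ 2 $ 1 = g $ 1 $ 2"
    by (simp add: transpose_def)
  have quad: "v \<bullet> (g *v v) > 0" if "v \<noteq> 0" for v
    using assms that unfolding pos_def_def by blast
  have "axis 1 1 \<noteq> (0 :: real^2)"
    by (simp add: axis_eq_0_iff)
  from quad[OF this] show a: "g $ 1 $ 1 > 0"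
    by (simp add: inner_vec_def matrix_vector_mult_def sum_2 axis_def)
  define v :: "real^2" where "v = vector [- g $ 1 $ 2, g $ 1 $ 1]"
  have "v \<noteq> 0"
    using a unfolding v_def by (metis vector_2(2) zero_index less_irrefl)
  from quad[OF this] have "g $ 1 $ 1 * det g > 0"
    by (simp add: inner_vec_def matrix_vector_mult_def sum_2 v_def det_2 sym algebra_simps)
  with a show "det g > 0"
    by (simp add: zero_less_mult_iff)
qed

lemma compatible_complex_structure_iff:
  assumes "pos_def g"
  shows "compatible_complex_structure g J \<longleftrightarrow>
    J = (1 / sqrt (det g)) *\<^sub>R
      (vector [vector [- g $ 1 $ 2, g $ 1 $ 1], vector [- g $ 2 $ 2, g $ 1 $ 2]] :: real^2^2)"
    (is "_ \<longleftrightarrow> J = ?K")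
proof -
  define a b d s where "a = g $ 1 $ 1" "b = g $ 1 $ 2" "d = g $ 2 $ 2" "s = sqrt (det g)"
  note defs = this
  have g: "g $ 2 $ 1 = b" and a: "a > 0" and det: "det g > 0"
    using pos_def_2[OF assms] by (simp_all add: defs)
  have s: "s > 0" "s * s = a * d - b * b"
    using det g by (simp_all add: defs det_2)
  note gs = defs(1-3)[symmetric] g
  have K: "?K $ 1 $ 1 = - b / s" "?K $ 1 $ 2 = a / s" "?K $ 2 $ 1 = - d / s" "?K $ 2 $ 2 = b / s"
    by (simp_all add: defs)
  show ?thesis
  proof
    assume J: "compatible_complex_structure g J"
    define p q r t where "p = J $ 1 $ 1" "q = J $ 1 $ 2" "r = J $ 2 $ 1" "t = J $ 2 $ 2"
    note Js = this[symmetric]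
    have sq: "J ** J = - mat 1"
      and orth: "\<And>X Y. (X v* J) \<bullet> (g *v (Y v* J)) = X \<bullet> (g *v Y)"
      and ori: "\<And>X. X \<noteq> 0 \<Longrightarrow> det (vector [X, X v* J] :: real^2^2) > 0"
      using J unfolding compatible_complex_structure_def by blast+
    have "(J ** J) $ 1 $ 2 = 0" "(J ** J) $ 1 $ 1 = - 1"
      unfolding sq by (simp_all add: mat_def)
    then have J1: "q * (p + t) = 0" "p * p + q * r = - 1"
      by (simp_all add: matrix_matrix_mult_def sum_2 Js algebra_simps)
    have e1: "axis 1 1 \<noteq> (0 :: real^2)"
      by (simp add: axis_eq_0_iff)
    from ori[OF e1] have q: "q > 0"
      by (simp add: det_2 vector_matrix_mult_def sum_2 axis_def Js)
    with J1(1) have t: "t = - p"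
      by simp
    from orth[of "axis 1 1" "axis 1 1"] have o1: "a * p * p + 2 * b * p * q + d * q * q = a"
      by (simp add: inner_vec_def matrix_vector_mult_def vector_matrix_mult_def sum_2 axis_def
          Js gs algebra_simps)
    from orth[of "axis 1 1" "axis 2 1"]
    have o2: "p * (a * r + b * t) + q * (b * r + d * t) = b"
      by (simp add: inner_vec_def matrix_vector_mult_def vector_matrix_mult_def sum_2 axis_def
          Js gs algebra_simps)
    have qr: "q * r = - 1 - p * p"
      using J1 by simp
    have "p * (a * (q * r) - b * p * q) + q * (b * (q * r) - d * p * q) = b * q"
      using arg_cong[OF o2, of "\<lambda>u. q * u"] by (simp add: t algebra_simps)
    then have "- a * p - p * (a * p * p + 2 * b * p * q + d * q * q) - 2 * b * q = 0"
      unfolding qr by (simp add: algebra_simps)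
    then have ap: "a * p = - b * q"
      unfolding o1 by (simp add: algebra_simps)
    have "a * a = (a * p) * (a * p) + 2 * b * q * (a * p) + a * d * (q * q)"
      using arg_cong[OF o1, of "\<lambda>u. a * u"] by (simp add: algebra_simps)
    also have "\<dots> = (a * d - b * b) * (q * q)"
      unfolding ap by (simp add: algebra_simps)
    finally have "a * a = (s * s) * (q * q)"
      unfolding s .
    then have "a\<^sup>2 = (s * q)\<^sup>2"
      by (simp add: power2_eq_square algebra_simps)
    then have "a = s * q"
      using a s q by (simp add: power2_eq_iff_nonneg)
    then have q': "q = a / s"
      using s by simp
    have "a * (s * p) = a * (- b)"
      using arg_cong[OF ap, of "\<lambda>u. s * u"] arg_cong[OF \<open>a = s * q\<close>, of "\<lambda>u. b * u"]
      by (auto simp: ac_simps)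
    then have "s * p = - b"
      using a by (metis mult_left_cancel less_irrefl)
    then have p': "p = - b / s"
      using s by (simp add: field_simps)
    have "a * (r * s) = (s * s) * (q * r)"
      using \<open>a = s * q\<close> by (metis mult.assoc mult.commute)
    also have "\<dots> = - (s * s) - (s * p) * (s * p)"
      unfolding qr by (simp add: algebra_simps)
    also have "\<dots> = a * (- d)"
      unfolding \<open>s * p = - b\<close> s by simp
    finally have "r * s = - d"
      using a by (metis mult_left_cancel less_irrefl)
    then have r': "r = - d / s"
      using s by (simp add: field_simps)
    show "J = ?K"
      by (simp add: vec_eq_iff forall_2 K Js p' q' r' t) (simp add: defs)
  next
    assume J: "J = ?K"
    have Js: "J $ 1 $ 1 = - b / s" "J $ 1 $ 2 = a / s" "J $ 2 $ 1 = - d / s" "J $ 2 $ 2 = b / s"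
      unfolding J K by auto
    have ss: "a * d = s * s + b * b" using s by simp
    have 1: "J ** J = - mat 1"
      using s ss by (simp add: vec_eq_iff forall_2 matrix_matrix_mult_def sum_2 Js mat_def field_simps)
    have 2: "(X v* J) \<bullet> (g *v (Y v* J)) = X \<bullet> (g *v Y)" for X Y
    proof -
      define x1 x2 y1 y2 where "x1 = X $ 1" "x2 = X $ 2" "y1 = Y $ 1" "y2 = Y $ 2"
      note xy = this[symmetric]
      have "s * s * ((X v* J) \<bullet> (g *v (Y v* J))) =
          (- b * x1 - d * x2) * (a * (- b * y1 - d * y2) + b * (a * y1 + b * y2)) +
          (a * x1 + b * x2) * (b * (- b * y1 - d * y2) + d * (a * y1 + b * y2))"
        using s(1) by (simp add: inner_vec_def matrix_vector_mult_def vector_matrix_mult_def sum_2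
            Js gs xy field_simps)
      also have "\<dots> = (a * d - b * b) * (x1 * (a * y1 + b * y2) + x2 * (b * y1 + d * y2))"
        by algebra
      also have "\<dots> = s * s * (X \<bullet> (g *v Y))"
        unfolding s by (simp add: inner_vec_def matrix_vector_mult_def sum_2 gs xy)
      finally show ?thesis using s(1) by simp
    qed
    have 3: "det (vector [X, X v* J] :: real^2^2) > 0" if "X \<noteq> 0" for X
    proof -
      have "X \<bullet> (g *v X) > 0"
        using assms that unfolding pos_def_def by blast
      moreover have "det (vector [X, X v* J] :: real^2^2) = (X \<bullet> (g *v X)) / s"
        using s(1) by (simp add: det_2 inner_vec_def matrix_vector_mult_def vector_matrix_mult_def sum_2
            Js gs field_simps)
      ultimately show ?thesis using s(1) by simp
    qed
    show "compatible_complex_structure g J"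
      unfolding compatible_complex_structure_def using 1 2 3 by blast
  qed
qed

lemma metric_J_eq:
  assumes "pos_def g"
  shows "metric_J g = (1 / sqrt (det g)) *\<^sub>R
    vector [vector [- g $ 1 $ 2, g $ 1 $ 1], vector [- g $ 2 $ 2, g $ 1 $ 2]]"
  unfolding metric_J_def compatible_complex_structure_iff[OF assms] by (rule the_equality) auto

lemma kaehler_form_eq:
  assumes "pos_def g"
  shows "kaehler_form g = sqrt (det g) *\<^sub>R vector [vector [0, 1], vector [-1, 0]]"
proof -
  have "sqrt (det g) * sqrt (det g) = det g" "sqrt (det g) > 0"
    using pos_def_2[OF assms] by auto
  then show ?thesis
    using pos_def_2(1)[OF assms]
    by (simp add: kaehler_form_def metric_J_eq[OF assms] vec_eq_iff forall_2
        matrix_matrix_mult_def sum_2 det_2 field_simps)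
qed

lemma faraday_function_unique:
  assumes "pos_def (h a x)"
  shows "\<exists>!f. \<forall>i j. 2 * faraday (D a) x i j = f * kaehler_form (h a x) $ i $ j"
proof -
  define u where "u = sqrt (det (h a x))"
  have u: "u > 0"
    using pos_def_2[OF assms] by (simp add: u_def)
  have om: "kaehler_form (h a x) $ 1 $ 1 = 0" "kaehler_form (h a x) $ 2 $ 2 = 0"
    "kaehler_form (h a x) $ 1 $ 2 = u" "kaehler_form (h a x) $ 2 $ 1 = - u"
    by (simp_all add: kaehler_form_eq[OF assms] u_def)
  have F: "faraday (D a) x 1 1 = 0" "faraday (D a) x 2 2 = 0"
    "faraday (D a) x 2 1 = - faraday (D a) x 1 2"
    by (simp_all add: faraday_def diff_divide_distrib)
  have "(\<forall>i j. 2 * faraday (D a) x i j = f * kaehler_form (h a x) $ i $ j) \<longleftrightarrow>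
      f = 2 * faraday (D a) x 1 2 / u" for f
    unfolding forall_2 om F using u by (auto simp: eq_divide_eq)
  then show ?thesis by simp
qed

lemma faraday_density_eq:
  assumes "conformal_structure A C" "h \<in> C" "a \<in> A" "x \<in> chart_img a"
  shows "faraday_density C D a x = faraday_function h D a x * sqrt \<bar>det (h a x)\<bar>"
proof -
  have *: "faraday_function g D a x * sqrt \<bar>det (g a x)\<bar> = 2 * faraday (D a) x 1 2"
    if "g \<in> C" for g
  proof -
    have pd: "pos_def (g a x)"
      using assms that unfolding conformal_structure_def riemannian_metric_def by blast
    have "2 * faraday (D a) x 1 2 = faraday_function g D a x * kaehler_form (g a x) $ 1 $ 2"
      using theI'[OF faraday_function_unique[where h = g and a = a and x = x and D = D, OF pd]]
      unfolding faraday_function_def by blast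
    then show ?thesis
      using pos_def_2(3)[OF pd] by (simp add: kaehler_form_eq[OF pd])
  qed
  have "repr_metric C \<in> C"
    unfolding repr_metric_def using assms(2) by (metis someI_ex)
  from *[OF this] *[OF assms(2)] show ?thesis
    unfolding faraday_density_def by simp
qed

lemma complex_structure_eq:
  assumes "conformal_structure A C" "h \<in> C" "a \<in> A" "x \<in> chart_img a"
  shows "complex_structure C a x = metric_J (h a x)"
proof -
  obtain c where c: "c > 0" "repr_metric C a x = c *\<^sub>R h a x"
    using conformal_structure_repr_scale[OF assms] .
  have "(c *\<^sub>R g) *v Y = c *\<^sub>R (g *v Y)" for g :: "real^2^2" and Y
    by (simp add: scaleR_matrix_vector_assoc)
  then have "compatible_complex_structure (c *\<^sub>R h a x) = compatible_complex_structure (h a x)"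
    using c(1) by (intro ext) (simp add: compatible_complex_structure_def)
  then show ?thesis
    unfolding complex_structure_def metric_J_def c(2) by simp
qed

lemma Ricci_identity:
  assumes torsion: "\<And>i j k. \<Gamma> x i j k = \<Gamma> x j i k"
    and \<Gamma>: "\<And>i j k. (\<lambda>y. \<Gamma> y i j k) differentiable (at x)"
    and X: "\<And>k. (\<lambda>y. X y k) differentiable (at x)"
    and dX: "\<And>i k. pd i (\<lambda>y. X y k) differentiable (at x)"
    and comm: "\<And>i j k. pd i (pd j (\<lambda>y. X y k)) x = pd j (pd i (\<lambda>y. X y k)) x"
  shows "nabla_endo \<Gamma> (nabla_vec \<Gamma> X) x i j k - nabla_endo \<Gamma> (nabla_vec \<Gamma> X) x j i k =
         (\<Sum>p\<in>UNIV. curvature \<Gamma> x i j p k * X x p)"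
proof -
  have pd_add: "pd i (\<lambda>y. f y + g y) x = pd i f x + pd i g x"
    if "f differentiable (at x)" "g differentiable (at x)" for i and f g :: "real^2 \<Rightarrow> real"
  proof -
    have "((\<lambda>y. f y + g y) has_derivative
       (\<lambda>h. frechet_derivative f (at x) h + frechet_derivative g (at x) h)) (at x)"
      using that by (intro has_derivative_add) (simp_all add: frechet_derivative_works)
    from frechet_derivative_at[OF this, symmetric] show ?thesis
      unfolding pd_def by simp
  qed
  have pd_mult: "pd i (\<lambda>y. f y * g y) x = f x * pd i g x + pd i f x * g x"
    if "f differentiable (at x)" "g differentiable (at x)" for i and f g :: "real^2 \<Rightarrow> real"
  proof -
    have "((\<lambda>y. f y * g y) has_derivative
       (\<lambda>h. f x * frechet_derivative g (at x) h + frechet_derivative f (at x) h * g x)) (at x)"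
      using that by (intro has_derivative_mult) (simp_all add: frechet_derivative_works)
    from frechet_derivative_at[OF this, symmetric] show ?thesis
      unfolding pd_def by simp
  qed
  have pd_const: "pd i (\<lambda>y. c) z = 0" for i z and c :: real
    unfolding pd_def by simp
  have 1: "pd i (\<lambda>y. nabla_vec \<Gamma> X y j k) x =
      pd i (pd j (\<lambda>y. X y k)) x +
      (\<Sum>p\<in>UNIV. \<Gamma> x j p k * pd i (\<lambda>y. X y p) x + pd i (\<lambda>y. \<Gamma> y j p k) x * X x p)" for i j k
  proof -
    have "(\<lambda>y. nabla_vec \<Gamma> X y j k) =
        (\<lambda>y. pd j (\<lambda>y. X y k) y + (\<Gamma> y j 1 k * X y 1 + \<Gamma> y j 2 k * X y 2))"
      by (simp add: nabla_vec_def sum_2 fun_eq_iff)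
    then show ?thesis
      by (simp add: pd_add pd_mult \<Gamma> X dX sum_2)
  qed
  have 2: "nabla_vec \<Gamma> (\<lambda>_ l. if l = p then 1 else 0) y i k = \<Gamma> y i p k" for p y i k
    using exhaust_2[of p] by (auto simp: nabla_vec_def sum_2 pd_const)
  have 3: "curvature \<Gamma> x i j p k = nabla_endo \<Gamma> (\<lambda>y i k. \<Gamma> y i p k) x i j k
      - nabla_endo \<Gamma> (\<lambda>y i k. \<Gamma> y i p k) x j i k" for p
    unfolding curvature_def Let_def nabla_endo_def by (simp only: 2)
  show ?thesis
    unfolding 3 nabla_endo_def 1
    unfolding nabla_vec_def sum_2 comm[of j i] torsion[of j i]
    by (simp add: algebra_simps)
qed

end

theory Submission
  imports Defs
begin

text \<open>In a chart \<open>2F = \<Phi> \<epsilon>\<close>, where \<open>\<Phi>\<close> is the Faraday density and \<open>\<epsilon>\<close> the constant antisymmetric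
  symbol. Viewed as a section of weight \<open>-1\<close>, \<open>\<epsilon>\<close> is parallel, and \<open>J\<^sub>i\<^sup>q = \<epsilon>\<^bsub>ip\<^esub> H\<^bsup>pq\<^esup>\<close>. So the
  Einstein equation reads \<open>\<alpha> = 0\<close> for \<open>\<alpha>\<^sub>i = \<nabla>\<^sub>i R + J\<^sub>i\<^sup>p \<nabla>\<^sub>p \<Phi>\<close>. Since \<open>J\<^sup>2 = -1\<close>,
  \<open>2 \<nabla>\<^bsup>0,1\<^esup>(R - \<i> \<Phi>)\<close> has components \<open>\<alpha>\<^sub>i + \<i> J\<^sub>i\<^sup>p \<alpha>\<^sub>p\<close>, with real part \<open>\<alpha>\<close>.\<close>

section \<open>Partial derivatives in a chart\<close>

lemma pd_cong_open:
  assumes "open U" "x \<in> U" "f differentiable (at x)" "\<And>y. y \<in> U \<Longrightarrow> f y = g y"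
  shows "pd i f x = pd i g x"
  unfolding pd_def
  using frechet_derivative_transform_within_open[OF assms(3,1,2,4)] by simp

text \<open>Components of sections are meaningful only on chart images, so closed formulas for them
  hold only there. Openness of the chart image lets regularity pass from the formula to the
  section.\<close>

lemma differentiable_cong_open:
  assumes "open U" "x \<in> U" "f differentiable (at x)" "\<And>y. y \<in> U \<Longrightarrow> f y = g y"
  shows "g differentiable (at x)"
  using assms has_derivative_transform_within_open unfolding differentiable_def by blast

lemma pd_cmult:
  fixes f :: "real^2 \<Rightarrow> real"
  assumes "f differentiable (at x)"
  shows "pd i (\<lambda>y. c * f y) x = c * pd i f x"
proof -
  have "((\<lambda>y. c * f y) has_derivative (\<lambda>h. c * frechet_derivative f (at x) h)) (at x)"
    using assms by (intro has_derivative_mult_right) (simp add: frechet_derivative_works)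
  from frechet_derivative_at[OF this, symmetric] show ?thesis
    unfolding pd_def by simp
qed

lemma pd_Complex:
  fixes f g :: "real^2 \<Rightarrow> real"
  assumes "f differentiable (at x)" "g differentiable (at x)"
  shows "pd i (\<lambda>y. of_real (f y) - \<i> * of_real (g y)) x = Complex (pd i f x) (- pd i g x)"
proof -
  have "((\<lambda>y. of_real (f y) - \<i> * of_real (g y)) has_derivative
      (\<lambda>h. of_real (frechet_derivative f (at x) h) - \<i> * of_real (frechet_derivative g (at x) h)))
      (at x)"
    using assms by (intro has_derivative_diff has_derivative_mult_right has_derivative_of_real)
      (simp_all add: frechet_derivative_works)
  from frechet_derivative_at[OF this, symmetric] show ?thesis
    unfolding pd_def by (simp add: complex_eq_iff)
qed

lemma smooth_on_differentiable:
  assumes "smooth_on U f" "x \<in> U"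
  shows "f differentiable (at x)"
  using assms unfolding smooth_on_def by (metis iterated_derivative.simps(1))

lemma smooth_on_pd_differentiable:
  assumes "smooth_on U f" "x \<in> U"
  shows "pd i f differentiable (at x)"
proof -
  have "iterated_derivative [axis i 1] f differentiable (at x)"
    using assms unfolding smooth_on_def by blast
  then show ?thesis
    by (simp add: pd_def[abs_def])
qed

section \<open>Regularity of the Ricci tensor and of the normalized metric\<close>

lemma curvature_eq:
  "curvature \<Gamma> x i j p k =
    pd i (\<lambda>y. \<Gamma> y j p k) x - (\<Sum>q\<in>UNIV. \<Gamma> x i j q * \<Gamma> x q p k) + (\<Sum>q\<in>UNIV. \<Gamma> x i q k * \<Gamma> x j p q)
    - (pd j (\<lambda>y. \<Gamma> y i p k) x - (\<Sum>q\<in>UNIV. \<Gamma> x j i q * \<Gamma> x q p k)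
       + (\<Sum>q\<in>UNIV. \<Gamma> x j q k * \<Gamma> x i p q))"
proof -
  have "pd i (\<lambda>y. c) z = 0" for i z and c :: real
    unfolding pd_def by simp
  \<comment> \<open>The coordinate field has constant components, so only the Christoffel term
    survives.\<close>
  then have "nabla_vec \<Gamma> (\<lambda>_ l. if l = p then 1 else 0) y i k = \<Gamma> y i p k" for y i k
    using exhaust_2[of p] by (auto simp: nabla_vec_def sum_2)
  then show ?thesis
    unfolding curvature_def Let_def nabla_endo_def by simp
qed

lemma ricci_differentiable:
  assumes "\<And>i j k. smooth_on U (\<lambda>y. \<Gamma> y i j k)" "x \<in> U"
  shows "(\<lambda>y. ricci \<Gamma> y i j) differentiable (at x)"
proof -
  have "(\<lambda>y. \<Gamma> y i j k) differentiable (at x)" for i j k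
    using smooth_on_differentiable[OF assms] .
  moreover have "(\<lambda>y. pd l (\<lambda>y. \<Gamma> y i j k) y) differentiable (at x)" for i j k l
    using smooth_on_pd_differentiable[OF assms] .
  ultimately show ?thesis
    unfolding ricci_def curvature_eq sum_2
    by (intro differentiable_add differentiable_diff differentiable_mult)
qed

lemma matrix_component_differentiable:
  fixes f :: "real^2 \<Rightarrow> real^2^2"
  assumes "f differentiable (at x)"
  shows "(\<lambda>y. f y $ i $ j) differentiable (at x)"
proof -
  obtain f' where "(f has_derivative f') (at x)"
    using assms unfolding differentiable_def by blast
  then have "((\<lambda>y. f y $ i $ j) has_derivative (\<lambda>h. f' h $ i $ j)) (at x)"
    by (intro bounded_linear.has_derivative[OF bounded_linear_vec_nth])
  then show ?thesis
    unfolding differentiable_def by blast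
qed

lemma normalized_component_differentiable:
  fixes f :: "real^2 \<Rightarrow> real^2^2"
  assumes f: "f differentiable (at x)" and pos: "det (f x) > 0"
  shows "(\<lambda>y. f y $ i $ j / sqrt (det (f y))) differentiable (at x)"
proof -
  note c = matrix_component_differentiable[OF f]
  have "(\<lambda>y. det (f y)) differentiable (at x)"
    unfolding det_2 by (intro differentiable_diff differentiable_mult c)
  then obtain d' where "((\<lambda>y. det (f y)) has_derivative d') (at x)"
    unfolding differentiable_def by blast
  from has_derivative_real_sqrt[OF pos this]
  have "(\<lambda>y. sqrt (det (f y))) differentiable (at x)"
    unfolding differentiable_def by blast
  then show ?thesis
    using pos by (intro differentiable_divide c) auto
qed

section \<open>The inverse metric, the Faraday form and \<open>J\<close> in components\<close>

lemma matrix_inv_eqI: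
  fixes A B :: "real^'n^'n"
  assumes "A ** B = mat 1"
  shows "matrix_inv A = B"
proof -
  have "A ** B = mat 1 \<and> B ** A = mat 1"
    using assms matrix_left_right_inverse1[OF assms] by (rule conjI)
  then have "A ** matrix_inv A = mat 1 \<and> matrix_inv A ** A = mat 1"
    unfolding matrix_inv_def by (rule someI[where P = "\<lambda>X. A ** X = mat 1 \<and> X ** A = mat 1"])
  then have "matrix_inv A ** (A ** B) = B"
    unfolding matrix_mul_assoc by simp
  then show ?thesis
    unfolding assms by simp
qed

text \<open>The normalized matrix has determinant 1, so its inverse is its adjugate.\<close>

lemma inv_unimodular:
  assumes "pos_def g"
  shows "matrix_inv (unimodular g) = (1 / sqrt (det g)) *\<^sub>R
    vector [vector [g $ 2 $ 2, - g $ 1 $ 2], vector [- g $ 1 $ 2, g $ 1 $ 1]]" (is "_ = _ *\<^sub>R ?K")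
proof (rule matrix_inv_eqI)
  note sym = pos_def_2(1)[OF assms] and pos = pos_def_2(3)[OF assms]
  have "g ** ?K = det g *\<^sub>R mat 1"
    by (simp add: vec_eq_iff forall_2 matrix_matrix_mult_def sum_2 mat_def det_2 sym)
  moreover have "(c *\<^sub>R M) ** (c *\<^sub>R N) = (c * c) *\<^sub>R (M ** N)" for c and M N :: "real^2^2"
    by (simp add: vec_eq_iff matrix_matrix_mult_def sum_2 algebra_simps)
  ultimately have "unimodular g ** ((1 / sqrt (det g)) *\<^sub>R ?K) =
      (1 / sqrt (det g) * (1 / sqrt (det g)) * det g) *\<^sub>R mat 1"
    using pos by (simp add: unimodular_def)
  also have "\<dots> = mat 1"
    using pos by simp
  finally show "unimodular g ** ((1 / sqrt (det g)) *\<^sub>R ?K) = mat 1" .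
qed

lemma faraday_components:
  "faraday \<Gamma> x 1 1 = 0" "faraday \<Gamma> x 2 2 = 0" "faraday \<Gamma> x 2 1 = - faraday \<Gamma> x 1 2"
  by (simp_all add: faraday_def diff_divide_distrib)

text \<open>The 12 entry of the Kaehler form is \<open>sqrt (det h)\<close>, exactly the factor that
  turns the Faraday function into a density.\<close>

lemma faraday_density_eq_component:
  assumes "pos_def (repr_metric C a x)"
  shows "faraday_density C D a x = 2 * faraday (D a) x 1 2"
proof -
  have "2 * faraday (D a) x 1 2 =
      faraday_function (repr_metric C) D a x * kaehler_form (repr_metric C a x) $ 1 $ 2"
    using theI'[OF faraday_function_unique[where h = "repr_metric C" and a = a and x = x and D = D,
          OF assms]]
    unfolding faraday_function_def by blast
  then show ?thesis
    using pos_def_2(3)[OF assms] by (simp add: faraday_density_def kaehler_form_eq[OF assms])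
qed

text \<open>For an antisymmetric form the two Christoffel sums in the 12 component collapse to the
  trace of the Christoffel symbols times \<open>F_12\<close>, which is the correction term of a
  1-density.\<close>

lemma nabla_faraday_components:
  assumes F: "(\<lambda>y. faraday \<Gamma> y 1 2) differentiable (at x)"
  shows "2 * nabla_cov2 \<Gamma> 0 (faraday \<Gamma>) x q 1 2 = nabla_density \<Gamma> (\<lambda>y. 2 * faraday \<Gamma> y 1 2) x q"
    and "nabla_cov2 \<Gamma> 0 (faraday \<Gamma>) x q 2 1 = - nabla_cov2 \<Gamma> 0 (faraday \<Gamma>) x q 1 2"
    and "nabla_cov2 \<Gamma> 0 (faraday \<Gamma>) x q 1 1 = 0"
    and "nabla_cov2 \<Gamma> 0 (faraday \<Gamma>) x q 2 2 = 0"
  \<comment> \<open>The factor 2 serves the density, the factor -1 the component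
    \<open>F_21 = - F_12\<close>.\<close>
  using pd_cmult[OF F, of q 2] pd_cmult[OF F, of q "-1"]
  by (simp_all add: nabla_cov2_def nabla_density_def faraday_components sum_2 pd_def algebra_simps)

text \<open>Up to order and sign both matrices have the same entries. The equal off-diagonal entries
  are matched with different entries of \<open>J\<close>, so that each row of the inverse metric
  becomes, up to sign, one row of \<open>J\<close>.\<close>

lemma inv_weighted_metric_components:
  assumes "pos_def (repr_metric C a x)"
  shows "inv_weighted_metric C a x $ 1 $ 1 = - complex_structure C a x $ 2 $ 1"
    and "inv_weighted_metric C a x $ 1 $ 2 = - complex_structure C a x $ 2 $ 2"
    and "inv_weighted_metric C a x $ 2 $ 1 = complex_structure C a x $ 1 $ 1"
    and "inv_weighted_metric C a x $ 2 $ 2 = complex_structure C a x $ 1 $ 2"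
  by (simp_all add: inv_weighted_metric_def weighted_metric_def inv_unimodular[OF assms]
      complex_structure_def metric_J_eq[OF assms])

lemma metric_J_square:
  assumes "pos_def g"
  shows "metric_J g ** metric_J g = - mat 1"
  using compatible_complex_structure_iff[OF assms] metric_J_eq[OF assms]
  unfolding compatible_complex_structure_def by blast

section \<open>Regularity of the weighted scalar curvature, and the equivalence\<close>

lemma weighted_scalar_curvature_differentiable:
  assumes U: "open U" "x \<in> U"
    and \<Gamma>: "\<And>i j k. smooth_on U (\<lambda>y. D a y i j k)"
    and h: "repr_metric C a differentiable (at x)"
    and pos: "\<And>y. y \<in> U \<Longrightarrow> pos_def (repr_metric C a y)"
  shows "weighted_scalar_curvature C D a differentiable (at x)"
proof -
  let ?h = "repr_metric C a"
  let ?u = "\<lambda>i j y. ?h y $ i $ j / sqrt (det (?h y))"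
  let ?R = "\<lambda>i j y. ricci (D a) y i j"
  have "?u i j differentiable (at x)" for i j
    by (intro normalized_component_differentiable h pos_def_2 pos U)
  moreover have "?R i j differentiable (at x)" for i j
    using ricci_differentiable[OF \<Gamma> U(2)] .
  \<comment> \<open>This is the Ricci trace with the adjugate written out. Both mixed Ricci
    components stay, since the Ricci tensor may have an antisymmetric part.\<close>
  ultimately have "(\<lambda>y. ?u 2 2 y * ?R 1 1 y - ?u 1 2 y * ?R 1 2 y
      - ?u 1 2 y * ?R 2 1 y + ?u 1 1 y * ?R 2 2 y) differentiable (at x)"
    by (intro differentiable_add differentiable_diff differentiable_mult)
  then show ?thesis
    by (rule differentiable_cong_open[OF U])
      (simp add: weighted_scalar_curvature_def inv_weighted_metric_def weighted_metric_def
        inv_unimodular[OF pos] sum_2)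
qed

text \<open>The imaginary part is the real part multiplied by \<open>J\<close>.\<close>

lemma dbar_zero_iff:
  fixes J :: "real^2^2" and r f :: "2 \<Rightarrow> real"
  assumes "J ** J = - mat 1"
  shows "(\<forall>i. 1/2 * (Complex (r i) (- f i)
            + \<i> * (\<Sum>p\<in>UNIV. of_real (J $ i $ p) * Complex (r p) (- f p))) = 0) \<longleftrightarrow>
         (\<forall>i. r i + (\<Sum>p\<in>UNIV. J $ i $ p * f p) = 0)" (is "?L \<longleftrightarrow> ?R")
proof
  assume ?L
  then show ?R
    by (simp add: forall_2 sum_2 complex_eq_iff)
next
  assume ?R
  then have r: "r 1 = - (J $ 1 $ 1 * f 1 + J $ 1 $ 2 * f 2)"
    "r 2 = - (J $ 2 $ 1 * f 1 + J $ 2 $ 2 * f 2)"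
    by (simp_all add: forall_2 sum_2)
  have JJ: "J $ i $ 1 * J $ 1 $ j + J $ i $ 2 * J $ 2 $ j = (if i = j then -1 else 0)" for i j
    using arg_cong[OF assms, of "\<lambda>M. M $ i $ j"]
    by (simp add: matrix_matrix_mult_def sum_2 mat_def)
  \<comment> \<open>The real part vanishes by \<open>?R\<close>, that is \<open>r = - J f\<close>.
    Then \<open>J r = - J J f = f\<close>, which makes the imaginary part \<open>J r - f\<close>
    vanish.\<close>
  have "J $ i $ 1 * r 1 + J $ i $ 2 * r 2 =
      - ((J $ i $ 1 * J $ 1 $ 1 + J $ i $ 2 * J $ 2 $ 1) * f 1
         + (J $ i $ 1 * J $ 1 $ 2 + J $ i $ 2 * J $ 2 $ 2) * f 2)" for i
    unfolding r by (simp add: algebra_simps)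
  then have "J $ i $ 1 * r 1 + J $ i $ 2 * r 2 = f i" for i
    unfolding JJ using exhaust_2[of i] by auto
  with \<open>?R\<close> show ?L
    by (simp add: forall_2 sum_2 complex_eq_iff)
qed

theorem lemma6p3:
  fixes T :: "'a topology" and A :: "'a chart set"
    and P :: "'a connection set" and C :: "'a metric set"
    and D :: "'a connection"
  assumes "oriented_surface T A"
    and "AH_structure T A P C"
    and "aligned_representative A P C D"
    and "naive_Einstein A C D"
  shows "Einstein A C D \<longleftrightarrow>
         holomorphic_density A C D (complex_weighted_scalar_curvature C D)"
proof -
  have conn: "affine_connection A D"
    using assms(2,3)
    unfolding AH_structure_def projective_structure_def aligned_representative_def by blast
  obtain h0 where h0: "riemannian_metric A h0"
    and C: "C = {h'. riemannian_metric A h' \<and> conformally_equivalent A h0 h'}"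
    using assms(2) unfolding AH_structure_def conformal_structure_def by blast
  \<comment> \<open>Some member of \<open>C\<close> is needed for the choice in
    \<open>repr_metric\<close> to land in \<open>C\<close>.\<close>
  have "conformally_equivalent A h0 h0"
    unfolding conformally_equivalent_def by (rule exI[of _ "\<lambda>_. 1"]) simp
  then have "h0 \<in> C"
    using h0 C by blast
  then have "repr_metric C \<in> C"
    unfolding repr_metric_def by (metis someI_ex)
  then have metric: "riemannian_metric A (repr_metric C)"
    using C by blast
  \<comment> \<open>The naive Einstein condition is given, so it remains to compare the differential
    equation with holomorphy, point by point in each chart.\<close>
  have "(\<forall>i. nabla_density (D a) (weighted_scalar_curvature C D a) x i +
        2 * (\<Sum>p\<in>UNIV. \<Sum>q\<in>UNIV. inv_weighted_metric C a x $ p $ q *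
               nabla_cov2 (D a) 0 (faraday (D a)) x q i p) = 0) \<longleftrightarrow>
      (\<forall>i. nabla01 C D (complex_weighted_scalar_curvature C D) a x i = 0)"
    if a: "a \<in> A" and x: "x \<in> chart_img a" for a x
  proof -
    let ?U = "chart_img a"
    let ?J = "complex_structure C a x"
    let ?R = "weighted_scalar_curvature C D a" and ?\<Phi> = "faraday_density C D a"
    let ?r = "nabla_density (D a) ?R x" and ?f = "nabla_density (D a) ?\<Phi> x"
    have U: "open ?U"
      using assms(1) a unfolding oriented_surface_def by blast
    have \<Gamma>: "smooth_on ?U (\<lambda>y. D a y i j k)" for i j k
      using conn a unfolding affine_connection_def by blast
    have h: "repr_metric C a differentiable (at x)"
      using metric a x smooth_on_differentiable unfolding riemannian_metric_def by blast
    have pos: "pos_def (repr_metric C a y)" if "y \<in> ?U" for y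
      using metric a that unfolding riemannian_metric_def by blast
    have R: "?R differentiable (at x)"
      by (rule weighted_scalar_curvature_differentiable[where a = a and D = D, OF U x \<Gamma> h]) (rule pos)
    have F: "(\<lambda>y. faraday (D a) y 1 2) differentiable (at x)"
      unfolding faraday_def
      by (intro differentiable_minus differentiable_divide differentiable_diff differentiable_const
          ricci_differentiable[OF \<Gamma> x]) simp
    have \<Phi>_eq: "2 * faraday (D a) y 1 2 = ?\<Phi> y" if "y \<in> ?U" for y
      using faraday_density_eq_component[OF pos[OF that]] by simp
    have F2: "(\<lambda>y. 2 * faraday (D a) y 1 2) differentiable (at x)"
      using F by (intro differentiable_mult differentiable_const)
    have \<Phi>: "?\<Phi> differentiable (at x)"
      using differentiable_cong_open[OF U x F2 \<Phi>_eq] .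
    have f: "2 * nabla_cov2 (D a) 0 (faraday (D a)) x q 1 2 = ?f q" for q
      using pd_cong_open[OF U x F2 \<Phi>_eq, of q] \<Phi>_eq[OF x] nabla_faraday_components(1)[OF F, of q]
      by (simp add: nabla_density_def)
    \<comment> \<open>By antisymmetry only \<open>p\<close> different from \<open>i\<close>
      contributes. For \<open>i = 2\<close> the sign of \<open>F_21\<close> cancels the sign in the
      second row of \<open>J\<close>.\<close>
    have einstein: "2 * (\<Sum>p\<in>UNIV. \<Sum>q\<in>UNIV. inv_weighted_metric C a x $ p $ q *
          nabla_cov2 (D a) 0 (faraday (D a)) x q i p) = (\<Sum>q\<in>UNIV. ?J $ i $ q * ?f q)" for i
      using exhaust_2[of i]
      by (auto simp: sum_2 inv_weighted_metric_components[OF pos[OF x]] f[symmetric]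
          nabla_faraday_components(2-4)[OF F] algebra_simps)
    \<comment> \<open>The connection on densities is real, so it acts separately on real and
      imaginary parts.\<close>
    have S: "nabla_density (D a) (complex_weighted_scalar_curvature C D a) x i =
        Complex (?r i) (- ?f i)" for i
      using pd_Complex[OF R \<Phi>, of i]
      by (simp add: nabla_density_def complex_weighted_scalar_curvature_def[abs_def] complex_eq_iff
          algebra_simps)
    have "?J ** ?J = - mat 1"
      unfolding complex_structure_def by (rule metric_J_square[OF pos[OF x]])
    from dbar_zero_iff[OF this, of ?r ?f] show ?thesis
      unfolding nabla01_def S einstein by simp
  qed
  then show ?thesis
    using assms(4) unfolding Einstein_def holomorphic_density_def by blast
qed

end
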